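(* Let $X$ be a topological space, let $A,B$ be C*-algebras with an action of $X$, and let $\varphi:qA\to B$ be a *-homomorphism. The following are equivalent: (1) $\varphi$ is weakly $X$-equivariant; (2) $\varphi$ is $q_X$-equivariant; (3) $\varphi$ is $X$-equivariant as a homomorphism $q_XA\to B$.
   Context: For a C*-algebra $A$, $QA=A\star A$ is the free product C*-algebra with the two canonical inclusions $\iota,\bar\iota:A\to QA$, and $qA$ is the kernel of the map $QA\to A$ identifying the two copies of $A$; $qA$ is the closed two-sided ideal of $QA$ generated by the elements $qx=\iota(x)-\bar\iota(x)$, $x\in A$. Let $\mathcal O(X)$ be the lattice of open subsets of $X$ and $\mathcal I(A)$ the lattice of closed two-sided ideals of $A$. An action of $X$ on $A$ is an order preserving map $\mathcal O(X)\ni U\mapsto A(U)\in\mathcal I(A)$. A homomorphism (or linear map) $\psi:A\to B$ between C*-algebras with actions of $X$ is $X$-equivariant if $\psi(A(U))\subseteq B(U)$ for each $U\in\mathcal O(X)$. A homomorphism $\varphi:qA\to B$ is weakly $X$-equivariant if the maps $A\ni x\mapsto\varphi(\iota(x)z)$ and $A\ni x\mapsto\varphi(\bar\iota(x)z)$ are $X$-equivariant for each $z\in qA$. It is $q_X$-equivariant if the linear map $A\ni x\mapsto\varphi(qx)$ is $X$-equivariant. $q_XA$ denotes $qA$ with the action of $X$ for which $qA(U)$ is the closed two-sided ideal of $qA$ generated by $Q(A(U))\,qA+qA\,Q(A(U))$, where $Q(A(U))\subseteq QA$ is the C*-subalgebra generated by $\iota(A(U))$ and $\bar\iota(A(U))$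 (equivalently, $qA(U)$ is the kernel of the natural map $qA\to q(A/A(U))$). *)

theory Defs
  imports "HOL-Analysis.Analysis"
begin

section \<open>C*-algebras\<close>

text \<open>Not necessarily unital; the zero algebra is allowed. The real structure required by
  \<^class>\<open>real_normed_algebra\<close> is the restriction of the complex one.\<close>

class cstar_algebra = real_normed_algebra + banach +
  fixes scaleC :: "complex \<Rightarrow> 'a \<Rightarrow> 'a"  (infixr "*\<^sub>C" 75)
    and star :: "'a \<Rightarrow> 'a"
  assumes scaleR_scaleC: "r *\<^sub>R x = complex_of_real r *\<^sub>C x"
    and scaleC_add_right: "c *\<^sub>C (x + y) = c *\<^sub>C x + c *\<^sub>C y"
    and scaleC_add_left: "(c + d) *\<^sub>C x = c *\<^sub>C x + d *\<^sub>C x"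
    and scaleC_scaleC: "c *\<^sub>C (d *\<^sub>C x) = (c * d) *\<^sub>C x"
    and scaleC_one: "1 *\<^sub>C x = x"
    and mult_scaleC_left: "(c *\<^sub>C x) * y = c *\<^sub>C (x * y)"
    and mult_scaleC_right: "x * (c *\<^sub>C y) = c *\<^sub>C (x * y)"
    and norm_scaleC: "norm (c *\<^sub>C x) = cmod c * norm x"
    and star_add: "star (x + y) = star x + star y"
    and star_scaleC: "star (c *\<^sub>C x) = cnj c *\<^sub>C star x"
    and star_mult: "star (x * y) = star y * star x"
    and star_star: "star (star x) = x"
    and norm_star_mult: "norm (star x * x) = (norm x)\<^sup>2"

instantiation complex :: cstar_algebra
begin

definition scaleC_complex :: "complex \<Rightarrow> complex \<Rightarrow> complex" where "scaleC_complex c x = c * x"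
definition star_complex :: "complex \<Rightarrow> complex" where "star_complex = cnj"

instance
  by standard
    (auto simp: scaleC_complex_def star_complex_def scaleR_conv_of_real algebra_simps
      norm_mult power2_eq_square)

end

text \<open>The universal property of a free product quantifies over all C*-algebras, which cannot be
  done with a type class inside a formula. The C*-algebras tested there are therefore given by
  explicit operations on a carrier set.\<close>

record 'a cstar_record =
  car :: "'a set"
  zer :: 'a
  add :: "'a \<Rightarrow> 'a \<Rightarrow> 'a"
  mul :: "'a \<Rightarrow> 'a \<Rightarrow> 'a"
  scal :: "complex \<Rightarrow> 'a \<Rightarrow> 'a"
  adj :: "'a \<Rightarrow> 'a"
  nrm :: "'a \<Rightarrow> real"

definition diff :: "'a cstar_record \<Rightarrow> 'a \<Rightarrow> 'a \<Rightarrow> 'a" where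
  "diff D x y = add D x (scal D (- 1) y)"

locale cstar_structure =
  fixes D :: "'a cstar_record"
  assumes zer_closed: "zer D \<in> car D"
    and add_closed: "x \<in> car D \<Longrightarrow> y \<in> car D \<Longrightarrow> add D x y \<in> car D"
    and mul_closed: "x \<in> car D \<Longrightarrow> y \<in> car D \<Longrightarrow> mul D x y \<in> car D"
    and scal_closed: "x \<in> car D \<Longrightarrow> scal D c x \<in> car D"
    and adj_closed: "x \<in> car D \<Longrightarrow> adj D x \<in> car D"
    and add_ass: "x \<in> car D \<Longrightarrow> y \<in> car D \<Longrightarrow> z \<in> car D \<Longrightarrow>
        add D (add D x y) z = add D x (add D y z)"
    and add_comm: "x \<in> car D \<Longrightarrow> y \<in> car D \<Longrightarrow> add D x y = add D y x"
    and add_zer: "x \<in> car D \<Longrightarrow> add D (zer D) x = x"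
    and diff_self: "x \<in> car D \<Longrightarrow> diff D x x = zer D"
    and scal_add_right: "x \<in> car D \<Longrightarrow> y \<in> car D \<Longrightarrow>
        scal D c (add D x y) = add D (scal D c x) (scal D c y)"
    and scal_add_left: "x \<in> car D \<Longrightarrow> scal D (c + d) x = add D (scal D c x) (scal D d x)"
    and scal_scal: "x \<in> car D \<Longrightarrow> scal D c (scal D d x) = scal D (c * d) x"
    and scal_one: "x \<in> car D \<Longrightarrow> scal D 1 x = x"
    and mul_ass: "x \<in> car D \<Longrightarrow> y \<in> car D \<Longrightarrow> z \<in> car D \<Longrightarrow>
        mul D (mul D x y) z = mul D x (mul D y z)"
    and mul_add_left: "x \<in> car D \<Longrightarrow> y \<in> car D \<Longrightarrow> z \<in> car D \<Longrightarrow>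
        mul D (add D x y) z = add D (mul D x z) (mul D y z)"
    and mul_add_right: "x \<in> car D \<Longrightarrow> y \<in> car D \<Longrightarrow> z \<in> car D \<Longrightarrow>
        mul D x (add D y z) = add D (mul D x y) (mul D x z)"
    and mul_scal_left: "x \<in> car D \<Longrightarrow> y \<in> car D \<Longrightarrow> mul D (scal D c x) y = scal D c (mul D x y)"
    and mul_scal_right: "x \<in> car D \<Longrightarrow> y \<in> car D \<Longrightarrow> mul D x (scal D c y) = scal D c (mul D x y)"
    and adj_add: "x \<in> car D \<Longrightarrow> y \<in> car D \<Longrightarrow> adj D (add D x y) = add D (adj D x) (adj D y)"
    and adj_scal: "x \<in> car D \<Longrightarrow> adj D (scal D c x) = scal D (cnj c) (adj D x)"
    and adj_mul: "x \<in> car D \<Longrightarrow> y \<in> car D \<Longrightarrow> adj D (mul D x y) = mul D (adj D y) (adj D x)"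
    and adj_adj: "x \<in> car D \<Longrightarrow> adj D (adj D x) = x"
    and nrm_eq_0: "x \<in> car D \<Longrightarrow> nrm D x = 0 \<longleftrightarrow> x = zer D"
    and nrm_triangle: "x \<in> car D \<Longrightarrow> y \<in> car D \<Longrightarrow> nrm D (add D x y) \<le> nrm D x + nrm D y"
    and nrm_scal: "x \<in> car D \<Longrightarrow> nrm D (scal D c x) = cmod c * nrm D x"
    and nrm_mul: "x \<in> car D \<Longrightarrow> y \<in> car D \<Longrightarrow> nrm D (mul D x y) \<le> nrm D x * nrm D y"
    and nrm_adj_mul: "x \<in> car D \<Longrightarrow> nrm D (mul D (adj D x) x) = (nrm D x)\<^sup>2"
    and complete: "(\<And>n. s n \<in> car D) \<Longrightarrow>
        (\<And>e. e > 0 \<Longrightarrow> \<exists>N. \<forall>m\<ge>N. \<forall>n\<ge>N. nrm D (diff D (s m) (s n)) < e) \<Longrightarrow>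
        \<exists>l\<in>car D. (\<lambda>n::nat. nrm D (diff D (s n) l)) \<longlonglongrightarrow> 0"

definition star_hom :: "'a cstar_record \<Rightarrow> 'b cstar_record \<Rightarrow> ('a \<Rightarrow> 'b) \<Rightarrow> bool" where
  "star_hom C D f \<longleftrightarrow>
     (\<forall>x\<in>car C. f x \<in> car D) \<and>
     (\<forall>x\<in>car C. \<forall>y\<in>car C. f (add C x y) = add D (f x) (f y)) \<and>
     (\<forall>c. \<forall>x\<in>car C. f (scal C c x) = scal D c (f x)) \<and>
     (\<forall>x\<in>car C. \<forall>y\<in>car C. f (mul C x y) = mul D (f x) (f y)) \<and>
     (\<forall>x\<in>car C. f (adj C x) = adj D (f x))"

definition alg :: "'a::cstar_algebra set \<Rightarrow> 'a cstar_record" where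
  "alg S = \<lparr>car = S, zer = 0, add = (+), mul = (*), scal = scaleC, adj = star, nrm = norm\<rparr>"


section \<open>Subalgebras and ideals\<close>

definition cstar_subalgebra :: "'a::cstar_algebra set \<Rightarrow> bool" where
  "cstar_subalgebra S \<longleftrightarrow> closed S \<and> 0 \<in> S \<and>
     (\<forall>x\<in>S. \<forall>y\<in>S. x + y \<in> S) \<and> (\<forall>c. \<forall>x\<in>S. c *\<^sub>C x \<in> S) \<and>
     (\<forall>x\<in>S. \<forall>y\<in>S. x * y \<in> S) \<and> (\<forall>x\<in>S. star x \<in> S)"

definition cstar_generated :: "'a::cstar_algebra set \<Rightarrow> 'a set" where
  "cstar_generated G = \<Inter>{S. cstar_subalgebra S \<and> G \<subseteq> S}"

definition closed_ideal :: "'a::cstar_algebra set \<Rightarrow> 'a set \<Rightarrow> bool" where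
  "closed_ideal R I \<longleftrightarrow> I \<subseteq> R \<and> closed I \<and> 0 \<in> I \<and>
     (\<forall>x\<in>I. \<forall>y\<in>I. x + y \<in> I) \<and> (\<forall>c. \<forall>x\<in>I. c *\<^sub>C x \<in> I) \<and>
     (\<forall>r\<in>R. \<forall>x\<in>I. r * x \<in> I \<and> x * r \<in> I)"

definition closed_ideal_generated :: "'a::cstar_algebra set \<Rightarrow> 'a set \<Rightarrow> 'a set" where
  "closed_ideal_generated R G = \<Inter>{I. closed_ideal R I \<and> G \<subseteq> I}"

lemma cstar_structure_alg:
  fixes S :: "'a::cstar_algebra set"
  assumes "cstar_subalgebra S"
  shows "cstar_structure (alg S)"
proof -
  have minus: "(- 1) *\<^sub>C x = - x" for x :: 'a
    using scaleR_scaleC[of "-1" x] by simp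
  have d: "diff (alg S) x y = x - y" for x y
    by (simp add: diff_def alg_def minus)
  show ?thesis
  proof (unfold_locales, goal_cases)
    case (28 s)
    have "Cauchy s"
      using 28(2) unfolding Cauchy_def d by (simp add: alg_def dist_norm)
    then obtain l where l: "s \<longlonglongrightarrow> l"
      using Cauchy_convergent_iff convergent_def by blast
    have "l \<in> S"
      using l 28(1) assms closed_sequentially[of S s l]
      by (simp add: cstar_subalgebra_def alg_def)
    with l show ?case
      unfolding d by (auto simp: alg_def tendsto_norm_zero_iff LIM_zero_iff intro!: bexI[of _ l])
  qed (use assms in \<open>auto simp: d, auto simp: alg_def cstar_subalgebra_def
        scaleC_add_right scaleC_add_left
        scaleC_scaleC scaleC_one mult_scaleC_left mult_scaleC_right norm_scaleC star_add
        star_scaleC star_mult star_star norm_star_mult norm_triangle_ineq norm_mult_ineq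
        algebra_simps\<close>)
qed


section \<open>The free product $A \star A$ and the ideal $qA$\<close>

text \<open>The C*-algebra \<^typ>\<open>'q\<close> with \<open>\<iota>\<close>, \<open>\<iota>'\<close> is the free product of two copies of \<^typ>\<open>'a\<close>.
  Testing the universal property on C*-algebras carried by subsets of \<^typ>\<open>'a + 'q\<close> is no
  restriction. Only C*-algebras \<open>D\<close> generated by two homomorphic images of \<^typ>\<open>'a\<close>
  matter for existence of \<open>h\<close>. Such a \<open>D\<close> is zero if \<^typ>\<open>'a\<close> is; otherwise its cardinality is
  at most that of \<open>nat \<Rightarrow> 'a\<close>, which for a nonzero Banach space \<^typ>\<open>'a\<close> is that of \<^typ>\<open>'a\<close>.
  Hence \<open>D\<close> has a copy in \<^typ>\<open>'a + 'q\<close>. Moreover, the C*-subalgebra of \<^typ>\<open>'q\<close> generated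
  by the ranges of \<open>\<iota>\<close> and \<open>\<iota>'\<close> is itself such a \<open>D\<close>, so it is all of \<^typ>\<open>'q\<close>, which gives
  uniqueness of \<open>h\<close> for every target.\<close>

definition free_product ::
  "('a::cstar_algebra \<Rightarrow> 'q::cstar_algebra) \<Rightarrow> ('a \<Rightarrow> 'q) \<Rightarrow> bool" where
  "free_product \<iota> \<iota>' \<longleftrightarrow>
     star_hom (alg UNIV) (alg UNIV) \<iota> \<and> star_hom (alg UNIV) (alg UNIV) \<iota>' \<and>
     (\<forall>(D :: ('a + 'q) cstar_record) f g.
        cstar_structure D \<and> star_hom (alg UNIV) D f \<and> star_hom (alg UNIV) D g \<longrightarrow>
        (\<exists>!h. star_hom (alg UNIV) D h \<and> h \<circ> \<iota> = f \<and> h \<circ> \<iota>' = g))"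

definition fold_hom ::
  "('a::cstar_algebra \<Rightarrow> 'q::cstar_algebra) \<Rightarrow> ('a \<Rightarrow> 'q) \<Rightarrow> 'q \<Rightarrow> 'a" where
  "fold_hom \<iota> \<iota>' = (THE p. star_hom (alg UNIV) (alg UNIV) p \<and> p \<circ> \<iota> = id \<and> p \<circ> \<iota>' = id)"

lemma fold_hom_unique:
  fixes \<iota> \<iota>' :: "'a::cstar_algebra \<Rightarrow> 'q::cstar_algebra"
  assumes "free_product \<iota> \<iota>'"
  shows "\<exists>!p. star_hom (alg UNIV) (alg (UNIV :: 'a set)) p \<and> p \<circ> \<iota> = id \<and> p \<circ> \<iota>' = id"
proof -
  define D :: "('a + 'q) cstar_record" where
    "D = \<lparr>car = range Inl, zer = Inl 0, add = (\<lambda>x y. Inl (projl x + projl y)),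
       mul = (\<lambda>x y. Inl (projl x * projl y)), scal = (\<lambda>c x. Inl (c *\<^sub>C projl x)),
       adj = (\<lambda>x. Inl (star (projl x))), nrm = (\<lambda>x. norm (projl x))\<rparr>"
  interpret A: cstar_structure "alg (UNIV :: 'a set)"
    by (rule cstar_structure_alg) (simp add: cstar_subalgebra_def)
  note sel = alg_def D_def
  have dd: "diff D (Inl x) (Inl y) = Inl (diff (alg UNIV) x y)" for x y
    by (simp add: diff_def sel)
  have D: "cstar_structure D"
  proof (unfold_locales, goal_cases)
    case (28 s)
    define t where "t n = projl (s n)" for n
    have s: "s n = Inl (t n)" for n
      using 28(1)[of n] by (auto simp: t_def D_def)
    have nrm: "nrm D (diff D (Inl x) (Inl y)) = nrm (alg UNIV) (diff (alg UNIV) x y)" for x y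
      unfolding dd by (simp add: sel)
    obtain l where l: "(\<lambda>n. nrm (alg UNIV) (diff (alg UNIV) (t n) l)) \<longlonglongrightarrow> 0"
      using A.complete[of t] 28(2) by (auto simp: s nrm alg_def)
    have "nrm D (diff D (s n) (Inl l)) = nrm (alg UNIV) (diff (alg UNIV) (t n) l)" for n
      unfolding s nrm ..
    with l show ?case
      by (intro bexI[of _ "Inl l"]) (simp_all add: D_def)
  next
    case (9 x)
    then show ?case
      using A.diff_self by (auto simp: sel dd[unfolded sel])
  qed (auto simp: D_def scaleC_add_right scaleC_add_left
        scaleC_scaleC scaleC_one mult_scaleC_left mult_scaleC_right norm_scaleC star_add
        star_scaleC star_mult star_star norm_star_mult norm_triangle_ineq norm_mult_ineq
        algebra_simps)
  have hom: "star_hom (alg UNIV) D h \<longleftrightarrow>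
      (\<exists>p. h = Inl \<circ> p \<and> star_hom (alg UNIV) (alg UNIV) p)"
    for h :: "'c::cstar_algebra \<Rightarrow> 'a + 'q"
  proof
    assume h: "star_hom (alg UNIV) D h"
    then have "h x \<in> range Inl" for x
      by (auto simp: star_hom_def sel)
    then have "h x = Inl (projl (h x))" for x
      by (metis imageE sum.sel(1))
    then have "h = Inl \<circ> (\<lambda>x. projl (h x))" by auto
    moreover have "star_hom (alg UNIV) (alg UNIV) (\<lambda>x. projl (h x))"
      using h by (auto simp: star_hom_def sel)
    ultimately show "\<exists>p. h = Inl \<circ> p \<and> star_hom (alg UNIV) (alg UNIV) p" by blast
  qed (auto simp: star_hom_def sel)
  have "star_hom (alg UNIV) D Inl"
    by (auto simp: star_hom_def sel)
  then have ex1: "\<exists>!h. star_hom (alg UNIV) D h \<and> h \<circ> \<iota> = Inl \<and> h \<circ> \<iota>' = Inl"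
    using assms D unfolding free_product_def by blast
  have eq: "Inl \<circ> p \<circ> k = Inl \<longleftrightarrow> p \<circ> k = id" for p :: "'q \<Rightarrow> 'a" and k :: "'a \<Rightarrow> 'q"
    by (auto simp: fun_eq_iff)
  from ex1 obtain p where p: "star_hom (alg UNIV) (alg (UNIV :: 'a set)) p"
      "p \<circ> \<iota> = id" "p \<circ> \<iota>' = id"
    using hom eq by metis
  moreover have "p' = p"
    if "star_hom (alg UNIV) (alg (UNIV :: 'a set)) p' \<and> p' \<circ> \<iota> = id \<and> p' \<circ> \<iota>' = id" for p'
  proof -
    have "Inl \<circ> p' = (Inl \<circ> p :: 'q \<Rightarrow> 'a + 'q)"
      using ex1 hom eq that p by blast
    then show ?thesis by (auto simp: fun_eq_iff)
  qed
  ultimately show ?thesis by blast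
qed

definition q_algebra ::
  "('a::cstar_algebra \<Rightarrow> 'q::cstar_algebra) \<Rightarrow> ('a \<Rightarrow> 'q) \<Rightarrow> 'q set" where
  "q_algebra \<iota> \<iota>' = {z. fold_hom \<iota> \<iota>' z = 0}"


section \<open>Actions of a space and equivariance\<close>

definition space_action :: "'x topology \<Rightarrow> 'a::cstar_algebra set \<Rightarrow> ('x set \<Rightarrow> 'a set) \<Rightarrow> bool" where
  "space_action X R \<alpha> \<longleftrightarrow>
     (\<forall>U. openin X U \<longrightarrow> closed_ideal R (\<alpha> U)) \<and>
     (\<forall>U V. openin X U \<and> openin X V \<and> U \<subseteq> V \<longrightarrow> \<alpha> U \<subseteq> \<alpha> V)"

definition equivariant ::
  "'x topology \<Rightarrow> ('x set \<Rightarrow> 'a set) \<Rightarrow> ('x set \<Rightarrow> 'b set) \<Rightarrow> ('a \<Rightarrow> 'b) \<Rightarrow> bool" where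
  "equivariant X \<alpha> \<beta> \<psi> \<longleftrightarrow> (\<forall>U. openin X U \<longrightarrow> \<psi> ` \<alpha> U \<subseteq> \<beta> U)"

definition weakly_equivariant ::
  "'x topology \<Rightarrow> ('a::cstar_algebra \<Rightarrow> 'q::cstar_algebra) \<Rightarrow> ('a \<Rightarrow> 'q) \<Rightarrow>
   ('x set \<Rightarrow> 'a set) \<Rightarrow> ('x set \<Rightarrow> 'b set) \<Rightarrow> ('q \<Rightarrow> 'b) \<Rightarrow> bool" where
  "weakly_equivariant X \<iota> \<iota>' \<alpha> \<beta> \<phi> \<longleftrightarrow>
     (\<forall>z \<in> q_algebra \<iota> \<iota>'. equivariant X \<alpha> \<beta> (\<lambda>x. \<phi> (\<iota> x * z)) \<and>
                         equivariant X \<alpha> \<beta> (\<lambda>x. \<phi> (\<iota>' x * z)))"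

definition q_equivariant ::
  "'x topology \<Rightarrow> ('a::cstar_algebra \<Rightarrow> 'q::cstar_algebra) \<Rightarrow> ('a \<Rightarrow> 'q) \<Rightarrow>
   ('x set \<Rightarrow> 'a set) \<Rightarrow> ('x set \<Rightarrow> 'b set) \<Rightarrow> ('q \<Rightarrow> 'b) \<Rightarrow> bool" where
  "q_equivariant X \<iota> \<iota>' \<alpha> \<beta> \<phi> \<longleftrightarrow> equivariant X \<alpha> \<beta> (\<lambda>x. \<phi> (\<iota> x - \<iota>' x))"

definition q_action ::
  "('a::cstar_algebra \<Rightarrow> 'q::cstar_algebra) \<Rightarrow> ('a \<Rightarrow> 'q) \<Rightarrow> ('x set \<Rightarrow> 'a set) \<Rightarrow> 'x set \<Rightarrow> 'q set" where
  "q_action \<iota> \<iota>' \<alpha> U =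
     (let qA = q_algebra \<iota> \<iota>'; QU = cstar_generated (\<iota> ` \<alpha> U \<union> \<iota>' ` \<alpha> U)
      in closed_ideal_generated qA
           {a * z + w * b | a b z w. a \<in> QU \<and> b \<in> QU \<and> z \<in> qA \<and> w \<in> qA})"

end

theory Submission
  imports Defs
begin

text \<open>Write \<open>q x = \<iota> x - \<iota>' x\<close>. For a closed ideal \<open>J\<close>, \<open>b b\<^sup>* \<in> J\<close> implies \<open>b \<in> J\<close>. Weak
  equivariance puts \<open>\<phi>(q x z)\<close> into \<open>J\<close> for all \<open>z \<in> qA\<close>; with \<open>z = (q x)\<^sup>*\<close> this gives
  \<open>\<phi>(q x) \<in> J\<close>. Conversely, \<open>\<iota>(x) q(y) w = q(x y) w - q(x) \<iota>'(y) w\<close> shows that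
  \<open>\<phi>(\<iota>(x) v w) \<in> J\<close> for \<open>w \<in> qA\<close> and \<open>v\<close> in the closed right ideal generated by the \<open>q(y)\<close>.
  That ideal is all of \<open>qA\<close>, since modulo it \<open>\<iota>\<close> and \<open>\<iota>'\<close> agree. Taking
  \<open>w = (\<iota>(x) v)\<^sup>*\<close> gives weak equivariance. The elements \<open>a\<close> such that \<open>a\<close> and \<open>a\<^sup>*\<close>
  multiply \<open>qA\<close> into the preimage of \<open>J\<close> form a C*-algebra, which links weak equivariance to
  the ideals of \<open>q\<^sub>XA\<close>.\<close>

section \<open>Involution, scalars and norm in a C*-algebra\<close>

lemma scaleC_minus_one: "(- 1) *\<^sub>C x = - (x :: 'a::cstar_algebra)"
  using scaleR_scaleC[of "-1" x] by simp

lemma norm_star: "norm (star x) = norm (x :: 'a::cstar_algebra)"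
proof -
  have le: "norm y \<le> norm (star y)" for y :: 'a
  proof (cases "y = 0")
    case False
    have "norm y * norm y \<le> norm (star y) * norm y"
      using norm_mult_ineq[of "star y" y] by (simp add: norm_star_mult power2_eq_square)
    with False show ?thesis by simp
  qed simp
  from le[of x] le[of "star x"] show ?thesis by (simp add: star_star)
qed

lemma norm_mult_star: "norm (x * star x) = (norm (x :: 'a::cstar_algebra))\<^sup>2"
  using norm_star_mult[of "star x"] by (simp add: star_star norm_star)

lemma bounded_linear_scaleC: "bounded_linear (scaleC c :: 'a::cstar_algebra \<Rightarrow> 'a)"
  by (rule bounded_linear_intro[of _ "cmod c"])
    (simp_all add: scaleC_add_right scaleR_scaleC scaleC_scaleC mult.commute norm_scaleC)

lemma scaleC_diff_right: "c *\<^sub>C (x - y) = c *\<^sub>C x - c *\<^sub>C (y :: 'a::cstar_algebra)"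
  by (rule linear_diff[OF bounded_linear.linear[OF bounded_linear_scaleC]])

lemma bounded_linear_star: "bounded_linear (star :: 'a::cstar_algebra \<Rightarrow> 'a)"
  by (rule bounded_linear_intro[of _ 1]) (simp_all add: star_add star_scaleC scaleR_scaleC norm_star)

lemma star_zero: "star 0 = (0 :: 'a::cstar_algebra)"
  using norm_star[of "0 :: 'a"] by simp

lemma star_scaleR: "star (r *\<^sub>R x) = r *\<^sub>R star (x :: 'a::cstar_algebra)"
  by (simp add: scaleR_scaleC star_scaleC)

lemma scaleC_zero_right: "c *\<^sub>C 0 = (0 :: 'a::cstar_algebra)"
  using norm_scaleC[of c "0 :: 'a"] by simp

section \<open>Membership in closed ideals by way of \<open>x * star x\<close>\<close>

text \<open>The approximation is an ergodic average: for self-adjoint \<open>h\<close> the element \<open>v = 1 + \<i>h/N\<close> of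
  the unitization satisfies \<open>v\<^sup>* v = 1 + h\<^sup>2/N\<^sup>2\<close>, so its powers up to \<open>N\<^sup>2\<close> are bounded
  uniformly in \<open>N\<close>. Their average \<open>g\<close> is \<open>1\<close> plus a multiple of \<open>h\<close>, and \<open>h g\<close> telescopes to
  \<open>O(1/N)\<close>. Unlike functional calculus this needs no spectral theory.\<close>

lemma approx_by_mult_star_self:
  fixes x :: "'a::cstar_algebra"
  assumes "e > 0"
  shows "\<exists>z. norm (x - x * star x * z) < e"
proof -
  define h where "h = x * star x"
  have h_star: "star h = h" by (simp add: h_def star_mult star_star)
  define C where "C = exp ((norm h)\<^sup>2)"
  have C1: "C \<ge> 1" by (simp add: C_def)
  \<comment> \<open>This \<open>N\<close> is what the final estimate
    \<open>C * ((C + 1) / real N) < e\<^sup>2\<close> asks for.\<close>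
  obtain N :: nat where N: "C * (C + 1) / e\<^sup>2 < real N"
    using reals_Archimedean2 by blast
  have N0: "real N > 0"
    using N C1 assms by (smt (verit) divide_nonneg_nonneg mult_nonneg_nonneg zero_le_power2)
  define K where "K = N\<^sup>2"
  have K: "real K = real N * real N" by (simp add: K_def power2_eq_square)
  define c where "c = \<i> / of_nat N"
  have c: "cnj c = - c" "c * c = - of_real (1 / (real N)\<^sup>2)" "cmod c = 1 / real N"
    by (simp_all add: c_def norm_divide power2_eq_square)
  \<comment> \<open>There may be no unit, so \<open>1 + ih/N\<close> and the average
    \<open>g\<close> of its powers are represented by the left multiplications \<open>v\<close> and
    \<open>G\<close>.\<close>
  define v where "v y = y + c *\<^sub>C (h * y)" for y
  have v_sq: "star (v y) * v y = star y * y + (1 / (real N)\<^sup>2) *\<^sub>R (star (h * y) * (h * y))" for y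
  proof -
    have "star (v y) = star y + (- c) *\<^sub>C (star y * h)"
      by (simp add: v_def star_add star_scaleC star_mult h_star c)
    then have "star (v y) * v y = star y * y + (c *\<^sub>C (star y * (h * y)) + (- c) *\<^sub>C (star y * (h * y)))
        + (- (c * c)) *\<^sub>C (star y * h * (h * y))"
      by (simp add: v_def algebra_simps mult_scaleC_left mult_scaleC_right scaleC_scaleC
          scaleC_add_right)
    also have "c *\<^sub>C (star y * (h * y)) + (- c) *\<^sub>C (star y * (h * y)) = 0"
      using scaleC_add_left[of c "- c" "star y * (h * y)"] scaleR_scaleC[of 0 "star y * (h * y)"]
      by simp
    also have "- (c * c) = of_real (1 / (real N)\<^sup>2)" by (simp add: c)
    finally show ?thesis
      by (simp only: scaleR_scaleC star_mult h_star mult.assoc) simp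
  qed
  have v_norm: "(norm (v y))\<^sup>2 \<le> (1 + (norm h)\<^sup>2 / (real N)\<^sup>2) * (norm y)\<^sup>2" for y
  proof -
    have "(norm (v y))\<^sup>2 \<le> norm (star y * y) + norm ((1 / (real N)\<^sup>2) *\<^sub>R (star (h * y) * (h * y)))"
      unfolding norm_star_mult[symmetric, of "v y"] v_sq by (rule norm_triangle_ineq)
    also have "\<dots> = (norm y)\<^sup>2 + (norm (h * y))\<^sup>2 / (real N)\<^sup>2"
      by (simp add: norm_star_mult)
    also have "(norm (h * y))\<^sup>2 \<le> (norm h * norm y)\<^sup>2"
      by (intro power_mono norm_mult_ineq) simp
    finally show ?thesis
      by (simp add: algebra_simps power_mult_distrib divide_right_mono)
  qed
  have vk_norm2: "(norm ((v ^^ k) y))\<^sup>2 \<le> (1 + (norm h)\<^sup>2 / (real N)\<^sup>2) ^ k * (norm y)\<^sup>2" for k y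
  proof (induction k)
    case (Suc k)
    have "(norm ((v ^^ Suc k) y))\<^sup>2 \<le> (1 + (norm h)\<^sup>2 / (real N)\<^sup>2) * (norm ((v ^^ k) y))\<^sup>2"
      using v_norm[of "(v ^^ k) y"] by simp
    also have "\<dots> \<le> (1 + (norm h)\<^sup>2 / (real N)\<^sup>2) *
        ((1 + (norm h)\<^sup>2 / (real N)\<^sup>2) ^ k * (norm y)\<^sup>2)"
      by (intro mult_left_mono Suc) simp
    finally show ?case by (simp add: mult.assoc)
  qed simp
  have vk_norm: "norm ((v ^^ k) y) \<le> C * norm y" if "k \<le> K" for k y
  proof -
    have "(1 + (norm h)\<^sup>2 / (real N)\<^sup>2) ^ k \<le> (1 + (norm h)\<^sup>2 / (real N)\<^sup>2) ^ K"
      using that by (intro power_increasing) simp_all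
    also have "\<dots> \<le> exp ((norm h)\<^sup>2 / (real N)\<^sup>2) ^ K"
      by (intro power_mono exp_ge_add_one_self) simp
    also have "\<dots> = C"
      using N0 by (simp add: exp_of_nat_mult[symmetric] C_def K_def)
    \<comment> \<open>Since \<open>C \<ge> 1\<close>, weakening \<open>C\<close> to
      \<open>C\<^sup>2\<close> lets the estimate of squared norms yield the factor \<open>C\<close>
      without a root.\<close>
    finally have "(1 + (norm h)\<^sup>2 / (real N)\<^sup>2) ^ k \<le> C\<^sup>2"
      using C1 by (smt (verit) self_le_power zero_less_numeral)
    then have "(norm ((v ^^ k) y))\<^sup>2 \<le> (C * norm y)\<^sup>2"
      using vk_norm2[of k y] by (smt (verit) mult_right_mono power_mult_distrib zero_le_power2)
    then show ?thesis
      by (rule power2_le_imp_le) (use C1 in simp)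
  qed
  define G where "G y = (1 / real K) *\<^sub>R (\<Sum>k<K. (v ^^ k) y)" for y
  have K0: "real K > 0" using N0 by (simp add: K)
  have G_norm: "norm (G y) \<le> C * norm y" for y
  proof -
    have "norm (\<Sum>k<K. (v ^^ k) y) \<le> (\<Sum>k<K. C * norm y)"
      by (intro sum_norm_le vk_norm) simp
    then show ?thesis using K0 by (simp add: G_def field_simps)
  qed
  have vk_right: "(v ^^ k) a * b = (v ^^ k) (a * b)" for k a b
    by (induction k) (simp_all add: v_def distrib_right mult_scaleC_left mult.assoc)
  have G_right: "G a * b = G (a * b)" for a b
    by (simp add: G_def sum_distrib_right vk_right)
  have vk_left: "(v ^^ k) (h * y) = h * (v ^^ k) y" for k y
    by (induction k) (simp_all add: v_def distrib_left mult_scaleC_right)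
  have G_left: "G (h * y) = h * G y" for y
    by (simp add: G_def sum_distrib_left vk_left)
  have telescope: "c *\<^sub>C (h * (\<Sum>k<n. (v ^^ k) y)) = (v ^^ n) y - y" for n y
  proof (induction n)
    case 0
    show ?case by (simp add: scaleC_zero_right)
  next
    case (Suc n)
    then show ?case by (simp add: v_def distrib_left scaleC_add_right)
  qed
  have hG_norm: "norm (h * G y) \<le> (C + 1) * norm y / real N" for y
  proof -
    have "norm (h * (\<Sum>k<K. (v ^^ k) y)) / real N = norm ((v ^^ K) y - y)"
      unfolding telescope[symmetric] norm_scaleC c by simp
    also have "\<dots> \<le> C * norm y + norm y"
      using norm_triangle_ineq4[of "(v ^^ K) y" y] vk_norm[of K y] by simp
    finally have "norm (h * (\<Sum>k<K. (v ^^ k) y)) \<le> (C + 1) * norm y * real N"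
      using N0 by (simp add: field_simps)
    then have "norm (h * (\<Sum>k<K. (v ^^ k) y)) / real K \<le> (C + 1) * norm y * real N / real K"
      using K0 by (intro divide_right_mono) auto
    then show ?thesis using N0 by (simp add: G_def K)
  qed
  \<comment> \<open>Formally \<open>w\<close> is the adjoint of \<open>g h\<close>. The bound
    \<open>hG_norm\<close> controls \<open>h g y\<close> for each single \<open>y\<close>; the
    choice \<open>y = w\<close>, where \<open>star w * w = h * G w\<close>, turns it into a bound on
    \<open>w\<close> itself.\<close>
  define w where "w = star (G h)"
  have w_norm: "norm w \<le> (C + 1) / real N"
  proof (cases "w = 0")
    case True
    then show ?thesis using C1 by simp
  next
    case False
    have "star w * w = h * G w"
      by (simp add: w_def star_star G_right G_left)
    then have "norm w * norm w \<le> (C + 1) * norm w / real N"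
      using hG_norm[of w] by (metis norm_star_mult power2_eq_square)
    then have "norm w * norm w \<le> ((C + 1) / real N) * norm w" by simp
    with False show ?thesis
      by (metis mult_right_le_imp_le zero_less_norm_iff)
  qed
  \<comment> \<open>From \<open>h\<close> back to \<open>x\<close>: the C*-identity expresses the
    squared norm of \<open>G x\<close> as the norm of \<open>G w\<close>, which is of order
    \<open>1/N\<close>.\<close>
  have "x * star (G x) = w"
    by (metis G_right h_def star_mult star_star w_def)
  then have "G x * star (G x) = G w"
    by (simp add: G_right)
  then have "(norm (G x))\<^sup>2 = norm (G w)"
    by (metis norm_mult_star)
  also have "\<dots> \<le> C * ((C + 1) / real N)"
    using G_norm[of w] w_norm C1 by (smt (verit) mult_left_mono)
  also have "\<dots> < e\<^sup>2"
    using N N0 assms by (simp add: field_simps)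
  finally have small: "norm (G x) < e"
    using assms by (simp add: power2_less_imp_less)
  \<comment> \<open>It remains to see that \<open>G x\<close> has the form \<open>x - h * z\<close>:
    each power of \<open>v\<close> changes \<open>x\<close> by a left multiple of \<open>h\<close>,
    and the weights of the average sum to 1.\<close>
  have "\<exists>z. (v ^^ k) x = x - h * z" for k
  proof (induction k)
    case (Suc k)
    then obtain z where z: "(v ^^ k) x = x - h * z" ..
    have "(v ^^ Suc k) x = x - h * (z - c *\<^sub>C (v ^^ k) x)"
      by (simp add: v_def z right_diff_distrib mult_scaleC_right)
    then show ?case by blast
  qed (auto intro: exI[of _ 0])
  then obtain z where z: "(v ^^ k) x = x - h * z k" for k by metis
  have "G x = x - h * ((1 / real K) *\<^sub>R (\<Sum>k<K. z k))"
    using K0 by (simp add: G_def z sum_subtractf sum_distrib_left scaleR_diff_right sum_constant_scaleR)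
  with small show ?thesis unfolding h_def by metis
qed

text \<open>The elements \<open>x * star x * z\<close> lie in \<open>I\<close> and come arbitrarily
  close to \<open>x\<close>, and \<open>I\<close> is closed.\<close>

lemma closed_ideal_mult_star_imp_mem:
  fixes x :: "'a::cstar_algebra"
  assumes I: "closed_ideal UNIV I" and x: "x * star x \<in> I"
  shows "x \<in> I"
proof -
  have "\<exists>y\<in>I. dist y x < e" if e: "e > 0" for e
  proof -
    obtain z where "norm (x - x * star x * z) < e"
      using approx_by_mult_star_self[OF e] by blast
    then have "dist (x * star x * z) x < e" by (metis dist_commute dist_norm)
    moreover have "x * star x * z \<in> I" using I x by (simp add: closed_ideal_def)
    ultimately show ?thesis by blast
  qed
  then have "x \<in> closure I" by (simp add: closure_approachable)
  with I show ?thesis by (simp add: closed_ideal_def)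
qed

text \<open>Closure under \<open>star\<close> is not part of \<open>closed_ideal\<close>; it follows
  from the previous lemma at \<open>star x\<close>, because \<open>star x * x\<close> is in
  \<open>I\<close>.\<close>

lemma closed_ideal_star:
  fixes x :: "'a::cstar_algebra"
  assumes "closed_ideal UNIV I" "x \<in> I"
  shows "star x \<in> I"
proof (rule closed_ideal_mult_star_imp_mem[OF assms(1)])
  show "star x * star (star x) \<in> I"
    using assms by (simp add: closed_ideal_def star_star)
qed

lemma closed_ideal_UNIV_closed:
  assumes "closed_ideal UNIV I"
  shows "0 \<in> I"
    and "x \<in> I \<Longrightarrow> y \<in> I \<Longrightarrow> x + y \<in> I"
    and "x \<in> I \<Longrightarrow> c *\<^sub>C x \<in> I"
    and "x \<in> I \<Longrightarrow> x * y \<in> I"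
    and "x \<in> I \<Longrightarrow> y * x \<in> I"
  using assms by (auto simp: closed_ideal_def)

lemma closed_ideal_diff:
  assumes "closed_ideal R I" "x \<in> I" "y \<in> I"
  shows "x - y \<in> I"
proof -
  have "x + (- 1) *\<^sub>C y \<in> I" using assms unfolding closed_ideal_def by blast
  then show ?thesis by (simp add: scaleC_minus_one)
qed

section \<open>Subalgebras and automatic continuity of homomorphisms\<close>

lemma cstar_subalgebra_diff:
  assumes "cstar_subalgebra S" "x \<in> S" "y \<in> S"
  shows "x - y \<in> S"
proof -
  have "x + (- 1) *\<^sub>C y \<in> S" using assms unfolding cstar_subalgebra_def by blast
  then show ?thesis by (simp add: scaleC_minus_one)
qed

lemma cstar_subalgebra_UNIV: "cstar_subalgebra UNIV"
  by (simp add: cstar_subalgebra_def)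

lemma star_hom_algD:
  assumes "star_hom (alg S) (alg T) f" "x \<in> S"
  shows "f x \<in> T"
    and "y \<in> S \<Longrightarrow> f (x + y) = f x + f y"
    and "f (c *\<^sub>C x) = c *\<^sub>C f x"
    and "y \<in> S \<Longrightarrow> f (x * y) = f x * f y"
    and "f (star x) = star (f x)"
  using assms by (auto simp: star_hom_def alg_def)

lemma star_hom_diff:
  assumes S: "cstar_subalgebra S" and f: "star_hom (alg S) (alg T) f" and "x \<in> S" "y \<in> S"
  shows "f (x - y) = f x - f y"
proof -
  have "(- 1) *\<^sub>C y \<in> S" using S assms(4) unfolding cstar_subalgebra_def by blast
  then have "f (x + (- 1) *\<^sub>C y) = f x + (- 1) *\<^sub>C f y"
    using assms(3,4) by (simp add: star_hom_algD[OF f])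
  then show ?thesis by (simp add: scaleC_minus_one)
qed

text \<open>\<open>E\<close> is of the form \<open>u - 1\<close> for an isometry \<open>u\<close> of the unitization.\<close>

lemma quasi_isometry_norm_le:
  fixes E :: "'a::cstar_algebra"
  assumes "E + star E + star E * E = 0"
  shows "norm E \<le> 2"
proof -
  \<comment> \<open>\<open>y + E * y\<close> is \<open>u y\<close>, and the isometry
    \<open>u\<close> preserves the norm of \<open>y\<close>. With \<open>y = star E\<close> the norm
    of \<open>E * y\<close> is the square of \<open>norm E\<close>.\<close>
  define y where "y = star E"
  have "star (y + E * y) * (y + E * y) = star y * y + star y * ((E + star E + star E * E) * y)"
    by (simp add: star_add star_mult algebra_simps)
  then have "norm (y + E * y) = norm y"
    using assms norm_star_mult[of "y + E * y"] norm_star_mult[of y] by simp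
  moreover have "norm (E * y) \<le> norm (y + E * y) + norm y"
    using norm_triangle_ineq4[of "y + E * y" y] by simp
  ultimately have "norm E * norm E \<le> 2 * norm E"
    using norm_mult_star[of E] by (simp add: y_def norm_star power2_eq_square)
  then show ?thesis
    by (cases "E = 0") auto
qed

text \<open>A small self-adjoint \<open>h\<close> is the imaginary part of the unitary \<open>(1 - h\<^sup>2)\<^bsup>1/2\<^esup> + \<i>h\<close>; here
  \<open>s = (1 - h\<^sup>2)\<^bsup>1/2\<^esup> - 1\<close> is found as a fixed point of a contraction.\<close>

lemma quasi_unitary_imaginary_part:
  fixes h :: "'a::cstar_algebra"
  assumes S: "cstar_subalgebra S" and h: "h \<in> S" "star h = h" "norm h \<le> 1 / 2"
  shows "\<exists>E\<in>S. E + star E + star E * E = 0 \<and> E - star E = (2 * \<i>) *\<^sub>C h"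
proof -
  \<comment> \<open>Commutation with \<open>h\<close> cancels the mixed terms of
    \<open>star E * E\<close>; the bound \<open>1 / 2\<close> makes \<open>F\<close> a contraction
    of \<open>M\<close> into itself.\<close>
  define M where "M = {s \<in> S. star s = s \<and> s * h = h * s \<and> norm s \<le> 1 / 2}"
  \<comment> \<open>\<open>F s = s\<close> says \<open>(1 + s)\<^sup>2 = 1 - h\<^sup>2\<close> in
    the unitization.\<close>
  define F where "F s = (- 1 / 2) *\<^sub>R (h * h + s * s)" for s
  have "closed M"
    unfolding M_def Collect_conj_eq using S
    by (intro closed_Int closed_Collect_eq closed_Collect_le continuous_intros
        bounded_linear.continuous_on[OF bounded_linear_star])
      (simp_all add: cstar_subalgebra_def)
  then have cM: "complete M" by (simp add: complete_eq_closed)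
  have "0 \<in> M" using S by (simp add: M_def cstar_subalgebra_def star_zero)
  have hh: "norm (h * h) \<le> 1 / 4"
  proof -
    have "norm (h * h) \<le> norm h * norm h" by (rule norm_mult_ineq)
    also have "\<dots> \<le> (1 / 2) * (1 / 2)" using h(3) by (intro mult_mono) auto
    finally show ?thesis by simp
  qed
  have FM: "F s \<in> M" if s: "s \<in> M" for s
  proof -
    have "norm (s * s) \<le> norm s * norm s" by (rule norm_mult_ineq)
    also have "\<dots> \<le> (1 / 2) * (1 / 2)" using s by (intro mult_mono) (auto simp: M_def)
    finally have "norm (h * h + s * s) \<le> 1 / 2"
      using hh norm_triangle_ineq[of "h * h" "s * s"] by simp
    then have "norm (F s) \<le> 1 / 2" by (simp add: F_def)
    moreover have "F s \<in> S"
      using s h(1) S unfolding F_def scaleR_scaleC M_def cstar_subalgebra_def by blast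
    moreover have "star (F s) = F s"
      using s by (simp only: F_def M_def mem_Collect_eq star_add star_mult star_scaleR h)
    moreover have "s * s * h = h * (s * s)" using s by (simp add: M_def) (metis mult.assoc)
    then have "F s * h = h * F s"
      by (simp add: F_def distrib_left distrib_right mult.assoc)
    ultimately show ?thesis by (simp add: M_def)
  qed
  have contr: "dist (F s) (F t) \<le> (1 / 2) * dist s t" if "s \<in> M" "t \<in> M" for s t
  proof -
    have "F s - F t = (- 1 / 2) *\<^sub>R (s * (s - t) + (s - t) * t)"
      by (simp add: F_def algebra_simps)
    then have "norm (F s - F t) = norm (s * (s - t) + (s - t) * t) / 2"
      by simp
    also have "norm (s * (s - t) + (s - t) * t) \<le> norm s * norm (s - t) + norm (s - t) * norm t"
      by (meson add_mono norm_mult_ineq norm_triangle_le)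
    also have "\<dots> \<le> (1 / 2) * norm (s - t) + norm (s - t) * (1 / 2)"
      using that by (intro add_mono mult_right_mono mult_left_mono) (auto simp: M_def)
    finally show ?thesis by (simp add: dist_norm)
  qed
  obtain s where s: "s \<in> M" "F s = s"
    using Banach_fix[OF cM, of "1 / 2" F] \<open>0 \<in> M\<close> FM contr by (auto simp: image_subset_iff)
  define E where "E = s + \<i> *\<^sub>C h"
  have minus: "(- c) *\<^sub>C y = - (c *\<^sub>C y)" for c and y :: 'a
    using scaleC_scaleC[of "- 1" c y] by (simp add: scaleC_minus_one)
  have sE: "star E = s - \<i> *\<^sub>C h"
    using s by (simp add: E_def M_def star_add star_scaleC h minus)
  have "E \<in> S" using s h(1) S by (simp add: E_def M_def cstar_subalgebra_def)
  moreover have "star E * E = s * s + h * h"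
    using s unfolding sE by (simp add: E_def M_def algebra_simps mult_scaleC_left mult_scaleC_right
        scaleC_scaleC scaleC_minus_one scaleC_diff_right)
  moreover have "s * s + h * h = - 2 *\<^sub>R s"
    using arg_cong[OF s(2), of "scaleR (- 2)"] by (simp add: F_def algebra_simps)
  moreover have "E + star E = 2 *\<^sub>R s" by (simp add: sE) (simp add: E_def scaleR_2)
  moreover have "E - star E = (\<i> + \<i>) *\<^sub>C h"
    unfolding scaleC_add_left sE by (simp add: E_def)
  ultimately show ?thesis by (intro bexI[of _ E]) simp_all
qed

text \<open>A homomorphism preserves the equation in \<open>quasi_isometry_norm_le\<close>. So
  \<open>f E\<close> has norm at most 2 when \<open>E\<close> has a small self-adjoint
  \<open>h\<close> as imaginary part, which bounds \<open>f h\<close>. Scaling covers all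
  self-adjoint elements and the C*-identity all of \<open>S\<close>. The domain is a subalgebra so
  that the bound applies to \<open>\<phi>\<close> on \<open>q_algebra\<close>.\<close>

lemma star_hom_norm_le:
  fixes f :: "'a::cstar_algebra \<Rightarrow> 'b::cstar_algebra"
  assumes S: "cstar_subalgebra S" and f: "star_hom (alg S) (alg T) f" and x: "x \<in> S"
  shows "norm (f x) \<le> 2 * norm x"
proof -
  note hom = star_hom_algD[OF f]
  have f0: "f 0 = 0"
    using star_hom_diff[OF S f x x] by simp
  have small: "norm (f h) \<le> 2" if h: "h \<in> S" "star h = h" "norm h \<le> 1 / 2" for h
  proof -
    obtain E where E: "E \<in> S" "E + star E + star E * E = 0" "E - star E = (2 * \<i>) *\<^sub>C h"
      using quasi_unitary_imaginary_part[OF S h] by blast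
    have mem: "star E \<in> S" "star E * E \<in> S" "E + star E \<in> S"
      using E(1) S by (auto simp: cstar_subalgebra_def)
    have "f (E + star E + star E * E) = f E + star (f E) + star (f E) * f E"
      using E(1) mem by (simp add: hom)
    then have "norm (f E) \<le> 2"
      using E(2) f0 by (intro quasi_isometry_norm_le) simp
    moreover have "f E - star (f E) = (2 * \<i>) *\<^sub>C f h"
      using arg_cong[OF E(3), of f] E(1) mem(1) h(1) by (simp add: star_hom_diff[OF S f] hom)
    then have "2 * norm (f h) = norm (f E - star (f E))"
      by (simp add: norm_scaleC norm_mult)
    ultimately show ?thesis
      using norm_triangle_ineq4[of "f E" "star (f E)"] by (simp add: norm_star)
  qed
  have selfadj: "norm (f h) \<le> 4 * norm h" if h: "h \<in> S" "star h = h" for h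
  proof (cases "h = 0")
    case False
    define r where "r = 1 / (2 * norm h)"
    have r: "r > 0" using False by (simp add: r_def)
    have "norm (f (r *\<^sub>R h)) \<le> 2"
    proof (rule small)
      show "r *\<^sub>R h \<in> S" using S h by (simp add: scaleR_scaleC cstar_subalgebra_def)
      show "star (r *\<^sub>R h) = r *\<^sub>R h" by (simp add: star_scaleR h)
      show "norm (r *\<^sub>R h) \<le> 1 / 2" using False by (simp add: r_def)
    qed
    then have "r * norm (f h) \<le> 2" using h r by (simp add: scaleR_scaleC hom norm_scaleC)
    then show ?thesis using False by (simp add: r_def field_simps)
  qed (simp add: f0)
  have "(norm (f x))\<^sup>2 = norm (f (star x * x))"
    using x S by (simp add: hom norm_star_mult cstar_subalgebra_def)
  also have "\<dots> \<le> 4 * norm (star x * x)"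
    using x S by (intro selfadj) (auto simp: cstar_subalgebra_def star_mult star_star)
  also have "\<dots> = (2 * norm x)\<^sup>2"
    by (simp add: norm_star_mult power_mult_distrib)
  finally show ?thesis
    by (rule power2_le_imp_le) simp
qed

lemma star_hom_continuous_on:
  fixes f :: "'a::cstar_algebra \<Rightarrow> 'b::cstar_algebra"
  assumes S: "cstar_subalgebra S" and f: "star_hom (alg S) (alg T) f"
  shows "continuous_on S f"
proof (rule continuous_on_iff[THEN iffD2], intro ballI allI impI)
  fix x and e :: real assume x: "x \<in> S" and e: "e > 0"
  have "dist (f y) (f x) < e" if y: "y \<in> S" "dist y x < e / 2" for y
    using star_hom_norm_le[OF S f, of "y - x"] cstar_subalgebra_diff[OF S y(1) x] y
      star_hom_diff[OF S f y(1) x] by (simp add: dist_norm)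
  then show "\<exists>d>0. \<forall>y\<in>S. dist y x < d \<longrightarrow> dist (f y) (f x) < e"
    using e by (intro exI[of _ "e / 2"]) auto
qed

section \<open>Generation of the free product by its two copies of the algebra\<close>

text \<open>\<open>free_product\<close> tests only C*-algebras carried by subsets of the sum type,
  so a subalgebra enters it through this copy under \<open>Inr\<close>.\<close>

definition alg_copy :: "'q::cstar_algebra set \<Rightarrow> ('a + 'q) cstar_record" where
  "alg_copy S = \<lparr>car = Inr ` S, zer = Inr 0, add = (\<lambda>x y. Inr (projr x + projr y)),
     mul = (\<lambda>x y. Inr (projr x * projr y)), scal = (\<lambda>c x. Inr (c *\<^sub>C projr x)),
     adj = (\<lambda>x. Inr (star (projr x))), nrm = (\<lambda>x. norm (projr x))\<rparr>"

lemma cstar_structure_alg_copy: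
  fixes S :: "'q::cstar_algebra set"
  assumes S: "cstar_subalgebra S"
  shows "cstar_structure (alg_copy S :: ('a + 'q) cstar_record)"
proof -
  let ?D = "alg_copy S :: ('a + 'q) cstar_record"
  interpret A: cstar_structure "alg S"
    by (rule cstar_structure_alg[OF S])
  have d: "diff ?D (Inr x) (Inr y) = Inr (x - y)" and d': "diff (alg S) x y = x - y" for x y
    by (simp_all add: diff_def alg_copy_def alg_def scaleC_minus_one)
  show ?thesis
  proof (unfold_locales, goal_cases)
    case (28 s)
    define t where "t n = projr (s n)" for n
    have s: "s n = Inr (t n)" "t n \<in> S" for n
      using 28(1)[of n] by (auto simp: t_def alg_copy_def)
    obtain l where "l \<in> S" "(\<lambda>n. norm (t n - l)) \<longlonglongrightarrow> 0"
      using A.complete[of t] 28(2) by (auto simp: s d d') (auto simp: alg_def alg_copy_def s)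
    then show ?case
      by (intro bexI[of _ "Inr l"]) (auto simp: s d, auto simp: alg_copy_def)
  qed (use S in \<open>auto simp: alg_copy_def cstar_subalgebra_def diff_def
        scaleC_minus_one scaleC_add_right scaleC_add_left
        scaleC_scaleC scaleC_one mult_scaleC_left mult_scaleC_right norm_scaleC star_add
        star_scaleC star_mult star_star norm_star_mult norm_triangle_ineq norm_mult_ineq
        algebra_simps\<close>)
qed

lemma cstar_subalgebra_generated: "cstar_subalgebra (cstar_generated G)"
  unfolding cstar_generated_def cstar_subalgebra_def
  by (intro conjI closed_Inter ballI allI) auto

lemma cstar_generated_superset: "G \<subseteq> cstar_generated G"
  by (auto simp: cstar_generated_def)

lemma cstar_generated_minimal: "cstar_subalgebra S \<Longrightarrow> G \<subseteq> S \<Longrightarrow> cstar_generated G \<subseteq> S"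
  by (auto simp: cstar_generated_def)

text \<open>The copy of the generated subalgebra receives a map \<open>h\<close> by the universal
  property. Regarded as maps into the copy of \<open>UNIV\<close>, \<open>h\<close> and
  \<open>Inr\<close> extend the same pair of homomorphisms, so they agree and the subalgebra is
  everything.\<close>

lemma free_product_generated:
  fixes \<iota> \<iota>' :: "'a::cstar_algebra \<Rightarrow> 'q::cstar_algebra"
  assumes fp: "free_product \<iota> \<iota>'"
  shows "cstar_generated (range \<iota> \<union> range \<iota>') = UNIV"
proof -
  define S where "S = cstar_generated (range \<iota> \<union> range \<iota>')"
  have S: "cstar_subalgebra S" by (simp add: S_def cstar_subalgebra_generated)
  have mem: "\<iota> a \<in> S" "\<iota>' a \<in> S" for a
    using cstar_generated_superset[of "range \<iota> \<union> range \<iota>'"] by (auto simp: S_def)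
  have hom: "star_hom (alg UNIV) (alg UNIV) \<iota>" "star_hom (alg UNIV) (alg UNIV) \<iota>'"
    using fp by (simp_all add: free_product_def)
  have homT: "star_hom (alg UNIV) (alg_copy T :: ('a + 'q) cstar_record) (Inr \<circ> k)"
    if "star_hom (alg UNIV) (alg UNIV) k" "range k \<subseteq> T" for T and k :: "'a \<Rightarrow> 'q"
    using that by (auto simp: star_hom_def alg_def alg_copy_def)
  have ex1: "\<exists>!h. star_hom (alg UNIV) (alg_copy T :: ('a + 'q) cstar_record) h \<and>
      h \<circ> \<iota> = Inr \<circ> \<iota> \<and> h \<circ> \<iota>' = Inr \<circ> \<iota>'"
    if "cstar_subalgebra T" "S \<subseteq> T" for T
    using fp cstar_structure_alg_copy[OF that(1), where 'a='a] homT[OF hom(1), of T]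
      homT[OF hom(2), of T] that(2) mem unfolding free_product_def by blast
  obtain h where h: "star_hom (alg UNIV) (alg_copy S :: ('a + 'q) cstar_record) h"
      "h \<circ> \<iota> = Inr \<circ> \<iota>" "h \<circ> \<iota>' = Inr \<circ> \<iota>'"
    using ex1[OF S] by blast
  have "star_hom (alg UNIV) (alg_copy UNIV :: ('a + 'q) cstar_record) h"
    using h(1) by (auto simp: star_hom_def alg_copy_def)
  moreover have "star_hom (alg UNIV) (alg_copy UNIV :: ('a + 'q) cstar_record) Inr"
    by (auto simp: star_hom_def alg_copy_def alg_def)
  ultimately have "h = Inr"
    using ex1[OF cstar_subalgebra_UNIV] h(2,3) by auto
  then have "Inr x \<in> (Inr ` S :: ('a + 'q) set)" for x
    using h(1) by (auto simp: star_hom_def alg_copy_def alg_def)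
  then show ?thesis by (auto simp: S_def)
qed

section \<open>The folding map and the ideal \<open>qA\<close>\<close>

context
  fixes \<iota> \<iota>' :: "'a::cstar_algebra \<Rightarrow> 'q::cstar_algebra"
  assumes fp: "free_product \<iota> \<iota>'"
begin

lemma fold_hom_star_hom: "star_hom (alg UNIV) (alg (UNIV :: 'a set)) (fold_hom \<iota> \<iota>')"
  and fold_hom_inclusion: "fold_hom \<iota> \<iota>' (\<iota> a) = a" "fold_hom \<iota> \<iota>' (\<iota>' a) = a"
  using theI'[OF fold_hom_unique[OF fp]] unfolding fold_hom_def[symmetric]
  by (auto simp: fun_eq_iff)

lemmas fold_hom = star_hom_algD(2-)[OF fold_hom_star_hom UNIV_I, simplified]

lemma inclusion_star_hom:
  "star_hom (alg UNIV) (alg UNIV) \<iota>" "star_hom (alg UNIV) (alg UNIV) \<iota>'"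
  using fp by (simp_all add: free_product_def)

lemmas inclusion = star_hom_algD(2-)[OF inclusion_star_hom(1) UNIV_I, simplified]
  star_hom_algD(2-)[OF inclusion_star_hom(2) UNIV_I, simplified]

lemmas continuous_on_UNIV_hom = star_hom_continuous_on[OF cstar_subalgebra_UNIV]

lemma fold_hom_0: "fold_hom \<iota> \<iota>' 0 = 0"
  using star_hom_diff[OF cstar_subalgebra_UNIV fold_hom_star_hom, of 0 0] by simp

lemma q_algebra_subalgebra: "cstar_subalgebra (q_algebra \<iota> \<iota>')"
  unfolding cstar_subalgebra_def q_algebra_def
  by (auto simp: fold_hom fold_hom_0 scaleC_zero_right star_zero
      intro!: closed_Collect_eq continuous_on_UNIV_hom[OF fold_hom_star_hom])

lemma q_algebra_mult:
  "z \<in> q_algebra \<iota> \<iota>' \<Longrightarrow> a * z \<in> q_algebra \<iota> \<iota>'"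
  "z \<in> q_algebra \<iota> \<iota>' \<Longrightarrow> z * a \<in> q_algebra \<iota> \<iota>'"
  by (simp_all add: q_algebra_def fold_hom)

lemma q_algebra_inclusion_diff: "\<iota> a - \<iota>' a \<in> q_algebra \<iota> \<iota>'"
  using star_hom_diff[OF cstar_subalgebra_UNIV fold_hom_star_hom, of "\<iota> a" "\<iota>' a"]
  by (simp add: q_algebra_def fold_hom_inclusion)

text \<open>Modulo \<open>N\<close> every element agrees with its image under \<open>\<iota> \<circ> fold_hom \<iota> \<iota>'\<close>.\<close>

lemma q_algebra_subset_right_ideal:
  assumes "closed N" "0 \<in> N"
    and add: "\<And>x y. x \<in> N \<Longrightarrow> y \<in> N \<Longrightarrow> x + y \<in> N"
    and scal: "\<And>c x. x \<in> N \<Longrightarrow> c *\<^sub>C x \<in> N"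
    and right: "\<And>x b. x \<in> N \<Longrightarrow> x * b \<in> N"
    and left: "\<And>a x. x \<in> N \<Longrightarrow> \<iota> a * x \<in> N"
    and gen: "\<And>a. \<iota> a - \<iota>' a \<in> N"
  shows "q_algebra \<iota> \<iota>' \<subseteq> N"
proof -
  define r where "r z = \<iota> (fold_hom \<iota> \<iota>' z)" for z
  have r: "r (x + y) = r x + r y" "r (x * y) = r x * r y" "r (c *\<^sub>C x) = c *\<^sub>C r x" for x y c
    by (simp_all add: r_def fold_hom inclusion)
  have r_cont: "continuous_on UNIV r"
    unfolding r_def
    by (rule continuous_on_compose2[OF continuous_on_UNIV_hom[OF inclusion_star_hom(1)]
        continuous_on_UNIV_hom[OF fold_hom_star_hom]]) simp
  define T where "T = {z. z - r z \<in> N}"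
  have r_star_cont: "continuous_on UNIV (\<lambda>z. r (star z))"
    by (rule continuous_on_compose2[OF r_cont])
      (auto intro: bounded_linear.continuous_on[OF bounded_linear_star] continuous_intros)
  have cT: "closed T"
    using continuous_closed_preimage[OF continuous_on_diff[OF continuous_on_id r_cont]
        closed_UNIV \<open>closed N\<close>]
    by (simp add: T_def vimage_def)
  have T0: "0 \<in> T"
    using inclusion(2)[of 0 0] r(3)[of 0 0] \<open>0 \<in> N\<close> scaleR_scaleC[of 0 "r 0"]
    by (simp add: T_def scaleC_zero_right)
  have Tadd: "x + y \<in> T" if "x \<in> T" "y \<in> T" for x y
    using add[of "x - r x" "y - r y"] that by (simp add: T_def r algebra_simps)
  have Tscal: "c *\<^sub>C x \<in> T" if "x \<in> T" for c x
    using scal[of "x - r x" c] that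
    by (simp add: T_def r scaleC_diff_right)
  have Tmult: "x * y \<in> T" if "x \<in> T" "y \<in> T" for x y
  proof -
    \<comment> \<open>\<open>r x\<close> lies in the range of \<open>\<iota>\<close>, so the second
      summand is covered by left multiplication with elements \<open>\<iota> a\<close>.\<close>
    have "x * y - r (x * y) = (x - r x) * y + r x * (y - r y)"
      by (simp add: r algebra_simps)
    then show ?thesis
      using that add right left by (simp add: T_def r_def)
  qed
  have Tinc: "\<iota> a \<in> T" "\<iota>' a \<in> T" for a
    using \<open>0 \<in> N\<close> scal[OF gen[of a], of "- 1"]
    by (simp_all add: T_def r_def fold_hom_inclusion scaleC_minus_one)
  \<comment> \<open>As \<open>N\<close> is only a right ideal, \<open>T\<close> need not be visibly
    closed under \<open>star\<close>; intersecting it with its preimage under \<open>star\<close>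
    gives a C*-subalgebra containing both ranges.\<close>
  have "closed {x. star x \<in> T}"
    using continuous_closed_preimage[OF _ closed_UNIV cT, of star]
      bounded_linear.continuous_on[OF bounded_linear_star continuous_on_id]
    by (auto simp: vimage_def)
  then have "closed (T \<inter> {x. star x \<in> T})"
    using cT by (rule closed_Int[rotated])
  then have "cstar_subalgebra (T \<inter> {x. star x \<in> T})"
    unfolding cstar_subalgebra_def
    by (auto simp: T0 Tadd Tscal Tmult star_zero star_add star_scaleC star_mult star_star)
  moreover have "range \<iota> \<union> range \<iota>' \<subseteq> T \<inter> {x. star x \<in> T}"
    by (auto simp: Tinc inclusion(4,8)[symmetric])
  ultimately have T: "T = UNIV"
    using cstar_generated_minimal free_product_generated[OF fp] by blast
  show ?thesis
  proof
    fix z assume "z \<in> q_algebra \<iota> \<iota>'"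
    moreover have "\<iota> 0 = 0"
      using star_hom_diff[OF cstar_subalgebra_UNIV inclusion_star_hom(1), of 0 0] by simp
    ultimately have "r z = 0" by (simp add: q_algebra_def r_def)
    moreover have "z \<in> T" by (simp add: T)
    ultimately show "z \<in> N" by (simp add: T_def)
  qed
qed

section \<open>The conditions at one open set, with ideals \<open>I\<close> and
  \<open>J\<close>\<close>

context
  fixes \<phi> :: "'q \<Rightarrow> 'b::cstar_algebra" and I :: "'a set" and J :: "'b set"
  assumes phi: "star_hom (alg (q_algebra \<iota> \<iota>')) (alg UNIV) \<phi>"
    and I: "closed_ideal UNIV I" and J: "closed_ideal UNIV J"
begin

private lemmas phi_hom = star_hom_algD(2-)[OF phi]
private lemmas phi_diff = star_hom_diff[OF q_algebra_subalgebra phi]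

private lemma phi_0: "\<phi> 0 = 0"
  using phi_diff[of 0 0] q_algebra_subalgebra by (simp add: cstar_subalgebra_def)

private lemmas J_closed = closed_ideal_UNIV_closed[OF J] closed_ideal_diff[OF J]

text \<open>Nothing is known of \<open>\<phi>\<close> outside \<open>q_algebra\<close>, so its
  continuity is used only after a continuous map \<open>f\<close> into
  \<open>q_algebra\<close>.\<close>

lemma closed_preimage_phi:
  assumes "continuous_on UNIV f" "\<And>x. f x \<in> q_algebra \<iota> \<iota>'"
  shows "closed {x. \<phi> (f x) \<in> J}"
proof -
  have "continuous_on UNIV (\<lambda>x. \<phi> (f x))"
    by (rule continuous_on_compose2[OF star_hom_continuous_on[OF q_algebra_subalgebra phi]])
      (use assms in auto)
  moreover have "closed J" using J by (simp add: closed_ideal_def)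
  ultimately show ?thesis
    using continuous_closed_preimage[of UNIV "\<lambda>x. \<phi> (f x)" J] by (simp add: vimage_def)
qed

lemma phi_mem_if_mult_star:
  assumes "z \<in> q_algebra \<iota> \<iota>'" "\<phi> (z * star z) \<in> J"
  shows "\<phi> z \<in> J"
proof -
  have "star z \<in> q_algebra \<iota> \<iota>'"
    using assms(1) q_algebra_subalgebra by (simp add: cstar_subalgebra_def)
  then show ?thesis
    using closed_ideal_mult_star_imp_mem[OF J, of "\<phi> z"] assms by (simp add: phi_hom)
qed

lemma weak_imp_q:
  assumes weak: "\<And>x z. x \<in> I \<Longrightarrow> z \<in> q_algebra \<iota> \<iota>' \<Longrightarrow> \<phi> (\<iota> x * z) \<in> J \<and> \<phi> (\<iota>' x * z) \<in> J"
    and x: "x \<in> I"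
  shows "\<phi> (\<iota> x - \<iota>' x) \<in> J"
proof (rule phi_mem_if_mult_star[OF q_algebra_inclusion_diff])
  define z where "z = star (\<iota> x - \<iota>' x)"
  have z: "z \<in> q_algebra \<iota> \<iota>'"
    using q_algebra_inclusion_diff q_algebra_subalgebra by (simp add: z_def cstar_subalgebra_def)
  then have "\<phi> ((\<iota> x - \<iota>' x) * z) = \<phi> (\<iota> x * z) - \<phi> (\<iota>' x * z)"
    by (simp add: left_diff_distrib phi_diff q_algebra_mult)
  then show "\<phi> ((\<iota> x - \<iota>' x) * star (\<iota> x - \<iota>' x)) \<in> J"
    using weak[OF x z] by (simp add: J_closed z_def)
qed

lemma q_imp_weak:
  assumes q: "\<And>x. x \<in> I \<Longrightarrow> \<phi> (\<iota> x - \<iota>' x) \<in> J"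
    and x: "x \<in> I" and z: "z \<in> q_algebra \<iota> \<iota>'"
  shows "\<phi> (\<iota> x * z) \<in> J \<and> \<phi> (\<iota>' x * z) \<in> J"
proof -
  \<comment> \<open>The last factor \<open>w\<close> keeps the arguments of \<open>\<phi>\<close>
    inside \<open>q_algebra\<close> for arbitrary \<open>z\<close>. Right multiplication of
    \<open>z\<close> by \<open>b\<close> is absorbed into \<open>b * w\<close>, left multiplication
    by \<open>\<iota> a\<close> into \<open>y * a\<close>.\<close>
  define N where "N = (\<Inter>w\<in>q_algebra \<iota> \<iota>'. \<Inter>y\<in>I.
    {z. \<phi> (\<iota> y * z * w) \<in> J} \<inter> {z. \<phi> (\<iota>' y * z * w) \<in> J})"
  have N_iff: "z \<in> N \<longleftrightarrow> (\<forall>w\<in>q_algebra \<iota> \<iota>'. \<forall>y\<in>I. \<phi> (\<iota> y * z * w) \<in> J \<and> \<phi> (\<iota>' y * z * w) \<in> J)" for z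
    by (auto simp: N_def)
  have q_mult: "\<phi> ((\<iota> y - \<iota>' y) * w) \<in> J" if "y \<in> I" "w \<in> q_algebra \<iota> \<iota>'" for y w
    using q[OF that(1)] that(2) by (simp add: phi_hom q_algebra_inclusion_diff J_closed)
  have I_mult: "y * a \<in> I" if "y \<in> I" for y a
    using I that by (simp add: closed_ideal_def)
  have "q_algebra \<iota> \<iota>' \<subseteq> N"
  proof (rule q_algebra_subset_right_ideal)
    show "closed N"
      unfolding N_def
      by (intro closed_INT ballI closed_Int closed_preimage_phi)
        (auto simp: q_algebra_mult intro!: continuous_intros)
    show "0 \<in> N" by (simp add: N_iff phi_0 J_closed)
    show "u + v \<in> N" if "u \<in> N" "v \<in> N" for u v
      using that by (simp add: N_iff distrib_left distrib_right phi_hom q_algebra_mult J_closed)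
    show "c *\<^sub>C u \<in> N" if "u \<in> N" for c u
      using that by (simp add: N_iff mult_scaleC_left mult_scaleC_right phi_hom q_algebra_mult J_closed)
    show "u * b \<in> N" if "u \<in> N" for u b
      unfolding N_iff
    proof (intro ballI)
      fix w y assume "w \<in> q_algebra \<iota> \<iota>'" "y \<in> I"
      then have "\<phi> (\<iota> y * u * (b * w)) \<in> J \<and> \<phi> (\<iota>' y * u * (b * w)) \<in> J"
        using that q_algebra_mult unfolding N_iff by blast
      then show "\<phi> (\<iota> y * (u * b) * w) \<in> J \<and> \<phi> (\<iota>' y * (u * b) * w) \<in> J"
        by (simp add: mult.assoc)
    qed
    show "\<iota> a * u \<in> N" if "u \<in> N" for a u
      unfolding N_iff
    proof (intro ballI)
      fix w y assume w: "w \<in> q_algebra \<iota> \<iota>'" and y: "y \<in> I"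
      have "\<phi> (\<iota> (y * a) * u * w) \<in> J"
        using w I_mult[OF y] that unfolding N_iff by blast
      then have 1: "\<phi> (\<iota> y * (\<iota> a * u) * w) \<in> J"
        by (simp add: inclusion mult.assoc)
      have "\<phi> ((\<iota> y - \<iota>' y) * (\<iota> a * u * w)) \<in> J"
        using w by (intro q_mult y q_algebra_mult)
      \<comment> \<open>\<open>\<iota>'\<close> does not combine with \<open>\<iota> a\<close>, so
        its term is obtained from the \<open>\<iota>\<close> term by subtracting a multiple of
        \<open>\<iota> y - \<iota>' y\<close>.\<close>
      moreover have "\<iota>' y * (\<iota> a * u) * w = \<iota> y * (\<iota> a * u) * w - (\<iota> y - \<iota>' y) * (\<iota> a * u * w)"
        by (simp add: algebra_simps)
      ultimately show "\<phi> (\<iota> y * (\<iota> a * u) * w) \<in> J \<and> \<phi> (\<iota>' y * (\<iota> a * u) * w) \<in> J"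
        using 1 w by (simp add: phi_diff q_algebra_mult J_closed)
    qed
    show "\<iota> a - \<iota>' a \<in> N" for a
      unfolding N_iff
    proof (intro ballI)
      fix w y assume w: "w \<in> q_algebra \<iota> \<iota>'" and y: "y \<in> I"
      \<comment> \<open>Both identities are twisted Leibniz rules: with
        \<open>q x = \<iota> x - \<iota>' x\<close>, the element \<open>q (y * a)\<close> equals
        \<open>\<iota> y * q a + q y * \<iota>' a\<close> and also
        \<open>\<iota>' y * q a + q y * \<iota> a\<close>.\<close>
      have "\<iota> y * (\<iota> a - \<iota>' a) * w = (\<iota> (y * a) - \<iota>' (y * a)) * w - (\<iota> y - \<iota>' y) * (\<iota>' a * w)"
        "\<iota>' y * (\<iota> a - \<iota>' a) * w = (\<iota> (y * a) - \<iota>' (y * a)) * w - (\<iota> y - \<iota>' y) * (\<iota> a * w)"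
        by (simp_all add: inclusion algebra_simps)
      then show "\<phi> (\<iota> y * (\<iota> a - \<iota>' a) * w) \<in> J \<and> \<phi> (\<iota>' y * (\<iota> a - \<iota>' a) * w) \<in> J"
        using w y by (simp add: phi_diff q_algebra_mult J_closed q_mult I_mult)
    qed
  qed
  with z have zN: "z \<in> N" by blast
  have "\<phi> (k x * z) \<in> J" if "k = \<iota> \<or> k = \<iota>'" for k
  proof (rule phi_mem_if_mult_star)
    show "k x * z \<in> q_algebra \<iota> \<iota>'" by (rule q_algebra_mult[OF z])
    \<comment> \<open>The adjoint of \<open>k x * z\<close> is the factor \<open>w\<close> to which
      membership of \<open>z\<close> in \<open>N\<close> is applied.\<close>
    then have "star (k x * z) \<in> q_algebra \<iota> \<iota>'"
      using q_algebra_subalgebra by (simp add: cstar_subalgebra_def)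
    then show "\<phi> (k x * z * star (k x * z)) \<in> J"
      using zN x that unfolding N_iff by blast
  qed
  then show ?thesis by blast
qed

lemma weak_imp_generated:
  assumes weak: "\<And>x z. x \<in> I \<Longrightarrow> z \<in> q_algebra \<iota> \<iota>' \<Longrightarrow> \<phi> (\<iota> x * z) \<in> J \<and> \<phi> (\<iota>' x * z) \<in> J"
    and a: "a \<in> cstar_generated (\<iota> ` I \<union> \<iota>' ` I)" and z: "z \<in> q_algebra \<iota> \<iota>'"
  shows "\<phi> (a * z) \<in> J"
proof -
  \<comment> \<open>The condition on \<open>star a\<close> makes \<open>T\<close> closed under
    \<open>star\<close>; the generators satisfy it because \<open>I\<close> is closed under
    \<open>star\<close>.\<close>
  define T where "T = (\<Inter>z\<in>q_algebra \<iota> \<iota>'. {a. \<phi> (a * z) \<in> J} \<inter> {a. \<phi> (star a * z) \<in> J})"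
  have T_iff: "a \<in> T \<longleftrightarrow> (\<forall>z\<in>q_algebra \<iota> \<iota>'. \<phi> (a * z) \<in> J \<and> \<phi> (star a * z) \<in> J)" for a
    by (auto simp: T_def)
  have "closed T"
    unfolding T_def
    by (intro closed_INT ballI closed_Int closed_preimage_phi continuous_intros
        bounded_linear.continuous_on[OF bounded_linear_star]) (auto simp: q_algebra_mult)
  have T: "\<phi> (a * z) \<in> J" "\<phi> (star a * z) \<in> J" if "a \<in> T" "z \<in> q_algebra \<iota> \<iota>'" for a z
    using that by (simp_all add: T_iff)
  have "x * y \<in> T" if "x \<in> T" "y \<in> T" for x y
    unfolding T_iff using that by (simp add: T star_mult mult.assoc q_algebra_mult)
  moreover have "x + y \<in> T" if "x \<in> T" "y \<in> T" for x y
    unfolding T_iff using that by (simp add: T star_add distrib_right phi_hom q_algebra_mult J_closed)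
  moreover have "c *\<^sub>C x \<in> T" if "x \<in> T" for c x
    unfolding T_iff using that
    by (simp add: T star_scaleC mult_scaleC_left phi_hom q_algebra_mult J_closed)
  moreover have "star x \<in> T" if "x \<in> T" for x
    unfolding T_iff using that by (simp add: T star_star)
  moreover have "0 \<in> T"
    by (simp add: T_iff star_zero phi_0 J_closed)
  ultimately have "cstar_subalgebra T"
    using \<open>closed T\<close> by (simp add: cstar_subalgebra_def)
  moreover have "\<iota> ` I \<union> \<iota>' ` I \<subseteq> T"
    using weak closed_ideal_star[OF I] by (auto simp: T_iff inclusion(4,8)[symmetric])
  ultimately have "a \<in> T" using a cstar_generated_minimal by blast
  with z show ?thesis by (simp add: T_iff)
qed

text \<open>The preimage of \<open>J\<close> in \<open>q_algebra\<close> is a closed ideal, so it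
  suffices that it contains the generators.\<close>

lemma weak_imp_ideal:
  assumes weak: "\<And>x z. x \<in> I \<Longrightarrow> z \<in> q_algebra \<iota> \<iota>' \<Longrightarrow> \<phi> (\<iota> x * z) \<in> J \<and> \<phi> (\<iota>' x * z) \<in> J"
  defines "S \<equiv> cstar_generated (\<iota> ` I \<union> \<iota>' ` I)"
  shows "\<phi> ` closed_ideal_generated (q_algebra \<iota> \<iota>') {a * z + w * b | a b z w.
      a \<in> S \<and> b \<in> S \<and> z \<in> q_algebra \<iota> \<iota>' \<and> w \<in> q_algebra \<iota> \<iota>'} \<subseteq> J"
proof -
  note qA = q_algebra_subalgebra[unfolded cstar_subalgebra_def]
  define P where "P = {z \<in> q_algebra \<iota> \<iota>'. \<phi> z \<in> J}"
  have "closed P"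
    using continuous_closed_preimage[OF star_hom_continuous_on[OF q_algebra_subalgebra phi]] qA J
    by (simp add: P_def vimage_def Int_def closed_ideal_def)
  then have "closed_ideal (q_algebra \<iota> \<iota>') P"
    unfolding closed_ideal_def
    by (auto simp: P_def qA phi_hom phi_0 J_closed)
  moreover have "a * z + w * b \<in> P"
    if "a \<in> S" "b \<in> S" and z: "z \<in> q_algebra \<iota> \<iota>'" and w: "w \<in> q_algebra \<iota> \<iota>'" for a b z w
  proof -
    \<comment> \<open>Weak equivariance concerns left factors; the adjoint turns
      \<open>w * b\<close> into \<open>star b * star w\<close>.\<close>
    have "star b \<in> S"
      using \<open>b \<in> S\<close> cstar_subalgebra_generated by (auto simp: S_def cstar_subalgebra_def)
    then have "\<phi> (star b * star w) \<in> J"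
      using weak_imp_generated[OF weak] w qA by (simp add: S_def)
    then have "star (\<phi> (star (w * b))) \<in> J"
      by (simp add: star_mult closed_ideal_star[OF J])
    then have "\<phi> (w * b) \<in> J"
      using w by (simp add: phi_hom star_star q_algebra_mult)
    moreover have "\<phi> (a * z) \<in> J"
      using weak_imp_generated[OF weak] \<open>a \<in> S\<close> z by (simp add: S_def)
    ultimately show ?thesis
      using z w by (simp add: P_def phi_hom qA q_algebra_mult J_closed)
  qed
  ultimately show ?thesis
    unfolding closed_ideal_generated_def by (auto simp: P_def)
qed

end

lemma inclusion_mult_mem_q_action:
  assumes "x \<in> \<alpha> U" "z \<in> q_algebra \<iota> \<iota>'"
  shows "\<iota> x * z \<in> q_action \<iota> \<iota>' \<alpha> U" "\<iota>' x * z \<in> q_action \<iota> \<iota>' \<alpha> U"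
proof -
  let ?S = "cstar_generated (\<iota> ` \<alpha> U \<union> \<iota>' ` \<alpha> U)"
  have "a * z \<in> q_action \<iota> \<iota>' \<alpha> U" if "a \<in> ?S" for a
  proof -
    have "0 \<in> ?S" "0 \<in> q_algebra \<iota> \<iota>'"
      using cstar_subalgebra_generated q_algebra_subalgebra by (auto simp: cstar_subalgebra_def)
    \<comment> \<open>Generators of the ideal have two summands; the zero elements fill the
      second.\<close>
    moreover have "a * z = a * z + 0 * 0" by simp
    ultimately have "a * z \<in> {a * z + w * b | a b z w. a \<in> ?S \<and> b \<in> ?S \<and>
        z \<in> q_algebra \<iota> \<iota>' \<and> w \<in> q_algebra \<iota> \<iota>'}" (is "_ \<in> ?G")
      using that assms(2) by blast
    moreover have "?G \<subseteq> q_action \<iota> \<iota>' \<alpha> U"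
      unfolding q_action_def Let_def closed_ideal_generated_def by (rule Inter_greatest) simp
    ultimately show ?thesis by (rule rev_subsetD)
  qed
  moreover have "\<iota> x \<in> ?S" "\<iota>' x \<in> ?S"
    using assms(1) by (auto intro!: subsetD[OF cstar_generated_superset])
  ultimately show "\<iota> x * z \<in> q_action \<iota> \<iota>' \<alpha> U" "\<iota>' x * z \<in> q_action \<iota> \<iota>' \<alpha> U"
    by auto
qed

end

theorem proposition4p2:
  fixes X :: "'x topology"
    and \<alpha> :: "'x set \<Rightarrow> 'a::cstar_algebra set"
    and \<beta> :: "'x set \<Rightarrow> 'b::cstar_algebra set"
    and \<iota> \<iota>' :: "'a \<Rightarrow> 'q::cstar_algebra"
    and \<phi> :: "'q \<Rightarrow> 'b"
  assumes "space_action X UNIV \<alpha>"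
    and "space_action X UNIV \<beta>"
    and "free_product \<iota> \<iota>'"
    and "star_hom (alg (q_algebra \<iota> \<iota>')) (alg UNIV) \<phi>"
  shows "(weakly_equivariant X \<iota> \<iota>' \<alpha> \<beta> \<phi> \<longleftrightarrow> q_equivariant X \<iota> \<iota>' \<alpha> \<beta> \<phi>) \<and>
         (q_equivariant X \<iota> \<iota>' \<alpha> \<beta> \<phi> \<longleftrightarrow> equivariant X (q_action \<iota> \<iota>' \<alpha>) \<beta> \<phi>)"
proof -
  have ideals: "closed_ideal UNIV (\<alpha> U)" "closed_ideal UNIV (\<beta> U)" if "openin X U" for U
    using assms(1,2) that by (simp_all add: space_action_def)
  \<comment> \<open>Moving the quantifier over \<open>z\<close> inside that over \<open>U\<close>
    allows the conditions to be compared one open set at a time.\<close>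
  have weak_iff: "weakly_equivariant X \<iota> \<iota>' \<alpha> \<beta> \<phi> \<longleftrightarrow> (\<forall>U. openin X U \<longrightarrow>
      (\<forall>x\<in>\<alpha> U. \<forall>z\<in>q_algebra \<iota> \<iota>'. \<phi> (\<iota> x * z) \<in> \<beta> U \<and> \<phi> (\<iota>' x * z) \<in> \<beta> U))"
    unfolding weakly_equivariant_def equivariant_def image_subset_iff by blast
  have q_iff: "q_equivariant X \<iota> \<iota>' \<alpha> \<beta> \<phi> \<longleftrightarrow>
      (\<forall>U. openin X U \<longrightarrow> (\<forall>x\<in>\<alpha> U. \<phi> (\<iota> x - \<iota>' x) \<in> \<beta> U))"
    unfolding q_equivariant_def equivariant_def image_subset_iff by blast
  have "q_equivariant X \<iota> \<iota>' \<alpha> \<beta> \<phi>" if "weakly_equivariant X \<iota> \<iota>' \<alpha> \<beta> \<phi>"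
    unfolding q_iff
  proof (intro allI impI ballI)
    fix U x assume U: "openin X U" and x: "x \<in> \<alpha> U"
    show "\<phi> (\<iota> x - \<iota>' x) \<in> \<beta> U"
      by (rule weak_imp_q[OF assms(3,4) ideals[OF U] _ x]) (use that U in \<open>simp add: weak_iff\<close>)
  qed
  moreover have "weakly_equivariant X \<iota> \<iota>' \<alpha> \<beta> \<phi>" if "q_equivariant X \<iota> \<iota>' \<alpha> \<beta> \<phi>"
    unfolding weak_iff
  proof (intro allI impI ballI)
    fix U x z assume U: "openin X U" and x: "x \<in> \<alpha> U" and z: "z \<in> q_algebra \<iota> \<iota>'"
    show "\<phi> (\<iota> x * z) \<in> \<beta> U \<and> \<phi> (\<iota>' x * z) \<in> \<beta> U"
      by (rule q_imp_weak[OF assms(3,4) ideals[OF U] _ x z]) (use that U in \<open>simp add: q_iff\<close>)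
  qed
  moreover have "equivariant X (q_action \<iota> \<iota>' \<alpha>) \<beta> \<phi>" if "weakly_equivariant X \<iota> \<iota>' \<alpha> \<beta> \<phi>"
    unfolding equivariant_def q_action_def Let_def
  proof (intro allI impI)
    fix U assume U: "openin X U"
    show "\<phi> ` closed_ideal_generated (q_algebra \<iota> \<iota>') {a * z + w * b | a b z w.
        a \<in> cstar_generated (\<iota> ` \<alpha> U \<union> \<iota>' ` \<alpha> U) \<and> b \<in> cstar_generated (\<iota> ` \<alpha> U \<union> \<iota>' ` \<alpha> U) \<and>
        z \<in> q_algebra \<iota> \<iota>' \<and> w \<in> q_algebra \<iota> \<iota>'} \<subseteq> \<beta> U"
      by (rule weak_imp_ideal[OF assms(3,4) ideals[OF U]]) (use that U in \<open>simp add: weak_iff\<close>)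
  qed
  moreover have "weakly_equivariant X \<iota> \<iota>' \<alpha> \<beta> \<phi>" if "equivariant X (q_action \<iota> \<iota>' \<alpha>) \<beta> \<phi>"
    unfolding weak_iff
  proof (intro allI impI ballI)
    fix U x z assume U: "openin X U" and "x \<in> \<alpha> U" "z \<in> q_algebra \<iota> \<iota>'"
    then have "\<iota> x * z \<in> q_action \<iota> \<iota>' \<alpha> U" "\<iota>' x * z \<in> q_action \<iota> \<iota>' \<alpha> U"
      by (simp_all add: inclusion_mult_mem_q_action[OF assms(3)])
    then show "\<phi> (\<iota> x * z) \<in> \<beta> U \<and> \<phi> (\<iota>' x * z) \<in> \<beta> U"
      using that U by (simp add: equivariant_def image_subset_iff)
  qed
  ultimately show ?thesis by (intro conjI iffI) simp_all
qed

end
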